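(* Let $G$ be a graph or a digraph and let $H$ be a da-hypomorph of $G$. Then $G\cong H$ if and only if $G$ has a pair of dacards $(A,\mathrm{dt}(A))$, $(B,\mathrm{dt}(B))$, obtained by deleting two distinct vertices of $G$, which is dapasted isomorphically in $G$ and $H$.
   Context: Digraphs are finite, without loops or multiple arcs; for distinct vertices $x,y$ both $xy$ and $yx$ may be arcs (together a biarc); an arc whose reverse is absent is an unpaired arc. A graph is regarded as a digraph in which every edge is a biarc. For a vertex $x$ of a digraph $D$, a vertex $w$ is an out-neighbor (in-neighbor) of $x$ if $xw$ ($wx$) is an unpaired arc, and a strong neighbor if $xw,wx$ are both arcs. The degree triple $\mathrm{dt}_D(x)=(a,b,c)$ consists of the numbers of out-, in- and strong neighbors of $x$ (for a graph it encodes the degree). A dacard of $D$ is a pair $(D-x,\mathrm{dt}_D(x))$ with $D-x$ taken up to isomorphism; two dacards are identical if the digraphs are isomorphic and the triples are equal. $\mathrm{Dadeck}(D)$ is the multiset of dacards of $D$ over all vertices; $D$ and $H$ are da-hypomorphs if they have the same dadeck. Dapasting: let $(A,\alpha)$, $(B,\beta)$ be dacards of $G$ obtained by deleting distinct vertices of $G$. A dapasting of them as members of $\mathrm{Dadeck}(G)$ is a digraph $P$ with two distinct non-adjacent vertices $u,v$, $u$ labeled $(e,\alpha)$ and $v$ labeled $(e,\beta)$ (all other vertices unlabeled), such that $P-u\cong A$, $P-v\cong B$, and there is $Y\in\{P,P+uv,P+vu,P+uv+vu\}$ ($P+xy$ = $P$ with arc $xy$ added) with $\mathrm{dt}_Y(u)=\alpha$,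 $\mathrm{dt}_Y(v)=\beta$ and $Y$ da-hypomorphic to $G$; any digraph isomorphic to such a $Y$ is a completion of $P$, and $u,v$ are the external vertices. $P$ is a dapasting in a digraph $J$ if $J$ is a completion of $P$. Two dapastings are isomorphic if there is a digraph isomorphism between them sending each vertex to a vertex with the same label (unlabeled to unlabeled). If $H$ is a da-hypomorph of $G$, the dacards $A,B$ are dapasted isomorphically in $G$ and $H$ if there exist a dapasting $P_1$ of $A,B$ (as members of $\mathrm{Dadeck}(G)$) in $G$ and a dapasting $P_2$ of $A,B$ (as members of $\mathrm{Dadeck}(G)$) in $H$ which are isomorphic as dapastings.
   Formalization: G is assumed to have at least two vertices; for a G with at most one vertex, G and H are isomorphic but there is no pair of distinct vertices to delete, so the equivalence as stated fails. *)

theory Defs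
  imports "Graph_Theory.Graph_Theory" "HOL-Library.Multiset"
begin

text \<open>
  Digraphs are those of the locale \<^locale>\<open>digraph\<close>: finite, without loops and without parallel
  arcs. Graphs (locale \<^locale>\<open>graph\<close>) are the digraphs in which every arc has its reverse, so every
  notion below covers both.
\<close>

type_synonym degtriple = "nat \<times> nat \<times> nat"

definition out_neighbors :: "('v,'e) pre_digraph \<Rightarrow> 'v \<Rightarrow> 'v set" where
  "out_neighbors D x = {w \<in> verts D. (x,w) \<in> arcs_ends D \<and> (w,x) \<notin> arcs_ends D}"

definition in_neighbors :: "('v,'e) pre_digraph \<Rightarrow> 'v \<Rightarrow> 'v set" where
  "in_neighbors D x = {w \<in> verts D. (w,x) \<in> arcs_ends D \<and> (x,w) \<notin> arcs_ends D}"

definition strong_neighbors :: "('v,'e) pre_digraph \<Rightarrow> 'v \<Rightarrow> 'v set" where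
  "strong_neighbors D x = {w \<in> verts D. (x,w) \<in> arcs_ends D \<and> (w,x) \<in> arcs_ends D}"

definition degree_triple :: "('v,'e) pre_digraph \<Rightarrow> 'v \<Rightarrow> degtriple" where
  "degree_triple D x =
     (card (out_neighbors D x), card (in_neighbors D x), card (strong_neighbors D x))"

type_synonym ('v,'e) dacard = "('v,'e) pre_digraph \<times> degtriple"

definition dacard :: "('v,'e) pre_digraph \<Rightarrow> 'v \<Rightarrow> ('v,'e) dacard" where
  "dacard D x = (pre_digraph.del_vert D x, degree_triple D x)"

text \<open>
  The isomorphism class of a finite digraph without parallel arcs, represented by its members with
  vertices in \<^typ>\<open>nat\<close>. Every finite digraph has such a copy, so two digraphs, possibly over
  different vertex types, have the same class exactly if they are isomorphic; see
  \<open>iso_class_eq_iff\<close> below.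
\<close>

definition iso_class :: "('v,'e) pre_digraph \<Rightarrow> nat pair_pre_digraph set" where
  "iso_class D = {K. digraph_iso D (with_proj K)}"

definition dadeck :: "('v,'e) pre_digraph \<Rightarrow> (nat pair_pre_digraph set \<times> degtriple) multiset" where
  "dadeck D = image_mset (\<lambda>x. map_prod iso_class id (dacard D x)) (mset_set (verts D))"

definition da_hypomorphic :: "('v,'e) pre_digraph \<Rightarrow> ('w,'f) pre_digraph \<Rightarrow> bool" where
  "da_hypomorphic D E \<longleftrightarrow> dadeck D = dadeck E"

text \<open>The labels \<open>(e, \<alpha>)\<close> of the external vertices are rendered as \<open>External \<alpha>\<close>.\<close>

datatype vlabel = Unlabeled | External degtriple

type_synonym 'v labeled_digraph = "'v pair_pre_digraph \<times> ('v \<Rightarrow> vlabel)"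

definition labeled_iso :: "'v labeled_digraph \<Rightarrow> 'w labeled_digraph \<Rightarrow> bool" where
  "labeled_iso P Q \<longleftrightarrow>
     (\<exists>h. pre_digraph.digraph_isomorphism (with_proj (fst P)) h \<and>
          with_proj (fst Q) = app_iso h (with_proj (fst P)) \<and>
          (\<forall>w \<in> pverts (fst P). snd Q (iso_verts h w) = snd P w))"

definition one_pair_extensions :: "'v pair_pre_digraph \<Rightarrow> 'v \<Rightarrow> 'v \<Rightarrow> ('v, 'v \<times> 'v) pre_digraph set"
  where
  "one_pair_extensions P u v =
     {with_proj P,
      pre_digraph.add_arc (with_proj P) (u,v),
      pre_digraph.add_arc (with_proj P) (v,u),
      pre_digraph.add_arc (pre_digraph.add_arc (with_proj P) (u,v)) (v,u)}"

text \<open>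
  \<open>dapasting_via G (A,\<alpha>) (B,\<beta>) (P,l) u v Y\<close>: the digraph \<open>P\<close> with labeling \<open>l\<close> is a dapasting of
  the two dacards as members of the dadeck of \<open>G\<close>, with external vertices \<open>u\<close>, \<open>v\<close> and witness \<open>Y\<close>.
\<close>

definition dapasting_via ::
  "('a,'b) pre_digraph \<Rightarrow> ('a,'b) dacard \<Rightarrow> ('a,'b) dacard \<Rightarrow>
   'v labeled_digraph \<Rightarrow> 'v \<Rightarrow> 'v \<Rightarrow> ('v, 'v \<times> 'v) pre_digraph \<Rightarrow> bool" where
  "dapasting_via G = (\<lambda>(A,\<alpha>) (B,\<beta>) (P,l) u v Y.
     pair_digraph P \<and> u \<in> pverts P \<and> v \<in> pverts P \<and> u \<noteq> v \<and>
     (u,v) \<notin> parcs P \<and> (v,u) \<notin> parcs P \<and>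
     l u = External \<alpha> \<and> l v = External \<beta> \<and> (\<forall>w \<in> pverts P - {u,v}. l w = Unlabeled) \<and>
     digraph_iso (pre_digraph.del_vert (with_proj P) u) A \<and>
     digraph_iso (pre_digraph.del_vert (with_proj P) v) B \<and>
     Y \<in> one_pair_extensions P u v \<and>
     degree_triple Y u = \<alpha> \<and> degree_triple Y v = \<beta> \<and> da_hypomorphic Y G)"

definition dapasting ::
  "('a,'b) pre_digraph \<Rightarrow> ('a,'b) dacard \<Rightarrow> ('a,'b) dacard \<Rightarrow> 'v labeled_digraph \<Rightarrow> bool" where
  "dapasting G a b P \<longleftrightarrow> (\<exists>u v Y. dapasting_via G a b P u v Y)"

definition completion ::
  "('a,'b) pre_digraph \<Rightarrow> ('a,'b) dacard \<Rightarrow> ('a,'b) dacard \<Rightarrow> 'v labeled_digraph \<Rightarrow>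
   ('c,'d) pre_digraph \<Rightarrow> bool" where
  "completion G a b P J \<longleftrightarrow> (\<exists>u v Y. dapasting_via G a b P u v Y \<and> digraph_iso Y J)"

definition dapasting_in ::
  "('a,'b) pre_digraph \<Rightarrow> ('a,'b) dacard \<Rightarrow> ('a,'b) dacard \<Rightarrow> 'v labeled_digraph \<Rightarrow>
   ('c,'d) pre_digraph \<Rightarrow> bool" where
  "dapasting_in G a b P J \<longleftrightarrow> dapasting G a b P \<and> completion G a b P J"

text \<open>
  Dapastings are finite digraphs, hence up to isomorphism of dapastings they have vertices in
  \<^typ>\<open>nat\<close>, and it suffices to let the existential quantifiers range over these.
\<close>

definition dapasted_isomorphically ::
  "('a,'b) pre_digraph \<Rightarrow> ('c,'d) pre_digraph \<Rightarrow> ('a,'b) dacard \<Rightarrow> ('a,'b) dacard \<Rightarrow> bool" where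
  "dapasted_isomorphically G H a b \<longleftrightarrow>
     (\<exists>(P1 :: nat labeled_digraph) (P2 :: nat labeled_digraph).
        dapasting_in G a b P1 G \<and> dapasting_in G a b P2 H \<and> labeled_iso P1 P2)"

lemma iso_class_nonempty:
  assumes "fin_digraph D" "nomulti_digraph D"
  shows "iso_class D \<noteq> {}"
proof -
  interpret fin_digraph D by fact
  interpret nomulti_digraph D by fact
  obtain f :: "_ \<Rightarrow> nat" where f: "inj_on f (verts D)"
    using finite_imp_inj_to_nat_seg[OF finite_verts] by blast
  define h where "h = \<lparr>iso_verts = f, iso_arcs = (\<lambda>a. (f (tail D a), f (head D a))),
    iso_head = snd, iso_tail = fst\<rparr>"
  have "inj_on (iso_arcs h) (arcs D)"
  proof (rule inj_onI)
    fix a b assume "a \<in> arcs D" "b \<in> arcs D" "iso_arcs h a = iso_arcs h b"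
    then show "a = b"
      using f by (intro no_multi_arcs) (auto simp: h_def arc_to_ends_def inj_on_eq_iff)
  qed
  then have iso: "digraph_isomorphism h"
    unfolding digraph_isomorphism_def using f wf_digraph by (simp add: h_def)
  have "app_iso h D = with_proj \<lparr>pverts = f ` verts D, parcs = iso_arcs h ` arcs D\<rparr>"
    by (simp add: app_iso_def with_proj_def h_def)
  then show ?thesis
    using iso unfolding iso_class_def digraph_iso_def by force
qed

lemma iso_class_eq_iff:
  assumes "fin_digraph D" "nomulti_digraph D" "fin_digraph E" "nomulti_digraph E"
  shows "iso_class D = iso_class E \<longleftrightarrow> digraph_iso D E"
proof -
  have wf: "wf_digraph D" "wf_digraph E"
    using assms(1,3) by (simp_all add: fin_digraph_def)
  show ?thesis
  proof
    assume eq: "iso_class D = iso_class E"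
    obtain K where K: "K \<in> iso_class D"
      using iso_class_nonempty[OF assms(1,2)] by blast
    then have "digraph_iso D (with_proj K)" "digraph_iso E (with_proj K)"
      using eq by (auto simp: iso_class_def)
    then show "digraph_iso D E"
      by (metis digraph_iso_trans digraph_iso_swap wf(2))
  next
    assume DE: "digraph_iso D E"
    then have ED: "digraph_iso E D"
      by (rule digraph_iso_swap[OF wf(1)])
    show "iso_class D = iso_class E"
      unfolding iso_class_def using digraph_iso_trans[OF DE] digraph_iso_trans[OF ED]
      by (intro Collect_cong iffI)
  qed
qed

end

theory Submission
  imports Defs
begin

text \<open>
  The external vertices \<open>u\<close>, \<open>v\<close> of a dapasting \<open>P\<close> are non-adjacent, so adding the arcs \<open>S\<close> between
  them changes the degree triple of \<open>u\<close> by \<open>(0,0,0)\<close>, \<open>(1,0,0)\<close>, \<open>(0,1,0)\<close> or \<open>(0,0,1)\<close> according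
  to \<open>S\<close>. Hence the label of \<open>u\<close> determines \<open>S\<close>, and an isomorphism between two dapastings is also
  one between their completions. Conversely, removing the arcs between two vertices of \<open>G\<close> yields a
  dapasting of the corresponding dacards, with completion \<open>G\<close> and, if \<open>G\<close> and \<open>H\<close> are isomorphic,
  also \<open>H\<close>.
\<close>

section \<open>Isomorphism reduced to vertex bijections preserving adjacency\<close>

definition ends_iso :: "('a \<Rightarrow> 'c) \<Rightarrow> ('a,'b) pre_digraph \<Rightarrow> ('c,'d) pre_digraph \<Rightarrow> bool" where
  "ends_iso f D E \<longleftrightarrow> bij_betw f (verts D) (verts E) \<and>
     (\<forall>x \<in> verts D. \<forall>y \<in> verts D. (f x, f y) \<in> arcs_ends E \<longleftrightarrow> (x,y) \<in> arcs_ends D)"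

lemma (in wf_digraph) arcs_ends_subset_verts: "arcs_ends G \<subseteq> verts G \<times> verts G"
  by (auto simp: arcs_ends_conv)

lemma ends_iso_app_iso:
  assumes "pre_digraph.digraph_isomorphism D h"
  shows "ends_iso (iso_verts h) D (app_iso h D)"
proof -
  interpret wf_digraph D
    using assms by (simp add: pre_digraph.digraph_isomorphism_def)
  have inj: "inj_on (iso_verts h) (verts D)"
    using assms by (rule digraph_isomorphism_inj_on_verts)
  have ends: "arcs_ends (app_iso h D) = map_prod (iso_verts h) (iso_verts h) ` arcs_ends D"
    using assms by (force simp: arcs_ends_conv iso_verts_tail iso_verts_head)
  \<comment> \<open>Only the direction from left to right needs injectivity: the preimage arc of an
    image pair must be \<open>(x,y)\<close> itself.\<close>
  have "(iso_verts h x, iso_verts h y) \<in> arcs_ends (app_iso h D) \<longleftrightarrow> (x,y) \<in> arcs_ends D"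
    if "x \<in> verts D" "y \<in> verts D" for x y
    unfolding ends using that arcs_ends_subset_verts inj by (force simp: inj_on_eq_iff image_iff)
  then show ?thesis
    using inj by (auto simp: ends_iso_def bij_betw_def)
qed

lemma digraph_isoD_ends_iso:
  assumes "digraph_iso D E"
  obtains f where "ends_iso f D E"
  using assms ends_iso_app_iso unfolding digraph_iso_def by blast

text \<open>Without parallel arcs an arc is determined by its ends, so the vertex map forces the arc
  map: injectivity of the latter comes from \<open>D\<close>, surjectivity from \<open>E\<close>.
  Later isomorphisms thus need a vertex map only.\<close>

lemma ends_iso_imp_digraph_iso:
  assumes "nomulti_digraph D" "nomulti_digraph E" and f: "ends_iso f D E"
  shows "digraph_iso D E"
proof -
  interpret D: nomulti_digraph D by fact
  interpret E: nomulti_digraph E by fact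
  have bij: "bij_betw f (verts D) (verts E)"
    and adj: "\<And>x y. x \<in> verts D \<Longrightarrow> y \<in> verts D \<Longrightarrow>
      (f x, f y) \<in> arcs_ends E \<longleftrightarrow> (x,y) \<in> arcs_ends D"
    using f by (auto simp: ends_iso_def)
  have "\<exists>b. b \<in> arcs E \<and> tail E b = f (tail D a) \<and> head E b = f (head D a)" if "a \<in> arcs D" for a
  proof -
    have "(tail D a, head D a) \<in> arcs_ends D"
      using that by (auto simp: arcs_ends_conv)
    then have "(f (tail D a), f (head D a)) \<in> arcs_ends E"
      using adj that by simp
    then show ?thesis
      by (auto simp: arcs_ends_conv)
  qed
  then obtain g where g: "\<And>a. a \<in> arcs D \<Longrightarrow>
      g a \<in> arcs E \<and> tail E (g a) = f (tail D a) \<and> head E (g a) = f (head D a)"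
    by metis
  have inj_f: "inj_on f (verts D)" and im_f: "f ` verts D = verts E"
    using bij by (auto simp: bij_betw_def)
  have "inj_on g (arcs D)"
  proof (rule inj_onI)
    fix a b assume ab: "a \<in> arcs D" "b \<in> arcs D" "g a = g b"
    then have "f (tail D a) = f (tail D b)" "f (head D a) = f (head D b)"
      using g by metis+
    then show "a = b"
      using ab inj_f by (intro D.no_multi_arcs) (auto simp: arc_to_ends_def inj_on_eq_iff)
  qed
  moreover have "arcs E \<subseteq> g ` arcs D"
  proof
    fix b assume b: "b \<in> arcs E"
    obtain x y where xy: "x \<in> verts D" "y \<in> verts D" "tail E b = f x" "head E b = f y"
      using b im_f by (metis E.tail_in_verts E.head_in_verts imageE)
    have "(f x, f y) \<in> arcs_ends E"
      using b by (auto simp: arcs_ends_conv simp flip: xy)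
    then obtain a where a: "a \<in> arcs D" "tail D a = x" "head D a = y"
      using adj xy by (auto simp: arcs_ends_conv)
    then have "b = g a"
      using g[of a] b xy by (intro E.no_multi_arcs) (auto simp: arc_to_ends_def)
    then show "b \<in> g ` arcs D"
      using a by blast
  qed
  then have im_g: "g ` arcs D = arcs E"
    using g by auto
  \<comment> \<open>Reusing \<open>tail E\<close> and \<open>head E\<close> makes
    \<open>app_iso h D\<close> equal to \<open>E\<close> as a record, beyond agreement on
    arcs.\<close>
  define h where
    "h = \<lparr>iso_verts = f, iso_arcs = g, iso_head = head E, iso_tail = tail E\<rparr>"
  have "D.digraph_isomorphism h"
    unfolding D.digraph_isomorphism_def
    using inj_f g D.wf_digraph \<open>inj_on g (arcs D)\<close> by (simp add: h_def)
  moreover have "E = app_iso h D"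
    by (rule pre_digraph.equality) (simp_all add: h_def im_f im_g)
  ultimately show ?thesis
    unfolding digraph_iso_def by blast
qed

section \<open>Invariance of degree triples, cards and dadecks\<close>

lemma degree_triple_ends_iso:
  assumes f: "ends_iso f D E" and x: "x \<in> verts D"
  shows "degree_triple E (f x) = degree_triple D x"
proof -
  have inj: "inj_on f (verts D)" and im: "verts E = f ` verts D"
    and adj: "\<And>x y. x \<in> verts D \<Longrightarrow> y \<in> verts D \<Longrightarrow>
      (f x, f y) \<in> arcs_ends E \<longleftrightarrow> (x,y) \<in> arcs_ends D"
    using f by (auto simp: ends_iso_def bij_betw_def)
  have "out_neighbors E (f x) = f ` out_neighbors D x"
    "in_neighbors E (f x) = f ` in_neighbors D x"
    "strong_neighbors E (f x) = f ` strong_neighbors D x"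
    using x adj
    by (auto simp: out_neighbors_def in_neighbors_def strong_neighbors_def im)
  moreover have "inj_on f (out_neighbors D x)" "inj_on f (in_neighbors D x)"
    "inj_on f (strong_neighbors D x)"
    using inj by (simp_all add: inj_on_def out_neighbors_def in_neighbors_def strong_neighbors_def)
  ultimately show ?thesis
    by (simp add: degree_triple_def card_image)
qed

lemma arcs_ends_del_vert:
  "arcs_ends (pre_digraph.del_vert D u) = {(x,y) \<in> arcs_ends D. x \<noteq> u \<and> y \<noteq> u}"
  by (auto simp: arcs_ends_conv pre_digraph.del_vert_simps)

lemma ends_iso_del_vert:
  assumes "ends_iso f D E" and "x \<in> verts D"
  shows "ends_iso f (pre_digraph.del_vert D x) (pre_digraph.del_vert E (f x))"
  using assms by (auto simp: ends_iso_def arcs_ends_del_vert pre_digraph.del_vert_simps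
      bij_betw_def inj_on_def)

lemma nomulti_digraph_del_vert:
  assumes "nomulti_digraph D"
  shows "nomulti_digraph (pre_digraph.del_vert D x)"
proof -
  interpret nomulti_digraph D by fact
  interpret d: wf_digraph "del_vert x" by (rule wf_digraph_del_vert)
  show ?thesis
    using no_multi_arcs by unfold_locales (simp add: del_vert_simps ends_del_vert)
qed

text \<open>An isomorphism \<open>f\<close> matches the card at \<open>x\<close> with the card at
  \<open>f x\<close>, so the dadeck of \<open>D\<close> is that of \<open>E\<close> re-indexed along
  \<open>f\<close>. This supplies the hypomorphy condition for the witness of a dapasting.\<close>

lemma da_hypomorphic_if_digraph_iso:
  assumes D: "fin_digraph D" "nomulti_digraph D" and E: "fin_digraph E" "nomulti_digraph E"
    and "digraph_iso D E"
  shows "da_hypomorphic D E"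
proof -
  obtain f where f: "ends_iso f D E"
    using \<open>digraph_iso D E\<close> by (rule digraph_isoD_ends_iso)
  have inj: "inj_on f (verts D)" and im: "f ` verts D = verts E"
    using f by (auto simp: ends_iso_def bij_betw_def)
  let ?card_class = "\<lambda>D x. map_prod iso_class id (dacard D x)"
  have "?card_class D x = ?card_class E (f x)" if x: "x \<in> verts D" for x
  proof -
    have "digraph_iso (pre_digraph.del_vert D x) (pre_digraph.del_vert E (f x))"
      using D E f x
      by (blast intro: ends_iso_imp_digraph_iso nomulti_digraph_del_vert ends_iso_del_vert)
    then have "iso_class (pre_digraph.del_vert D x) = iso_class (pre_digraph.del_vert E (f x))"
      using D E by (simp add: iso_class_eq_iff nomulti_digraph_del_vert
          fin_digraph.fin_digraph_del_vert)
    then show ?thesis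
      using degree_triple_ends_iso[OF f x] by (simp add: dacard_def)
  qed
  then have "dadeck D = image_mset (\<lambda>x. ?card_class E (f x)) (mset_set (verts D))"
    unfolding dadeck_def using fin_digraph.finite_verts[OF D(1)]
    by (intro image_mset_cong) simp
  also have "\<dots> = dadeck E"
    unfolding dadeck_def im[symmetric] image_mset_mset_set[OF inj, symmetric]
    by (simp add: multiset.map_comp comp_def)
  finally show ?thesis
    by (simp add: da_hypomorphic_def)
qed

section \<open>Adding arcs between two non-adjacent vertices\<close>

lemma nomulti_digraph_with_proj:
  "wf_digraph (with_proj P) \<Longrightarrow> nomulti_digraph (with_proj P)"
  by (auto simp: nomulti_digraph_def nomulti_digraph_axioms_def arc_to_ends_def prod_eq_iff)

text \<open>Treats the four cases uniformly by the set \<open>S\<close> of added arcs. Membership of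
  \<open>u\<close> and \<open>v\<close> matters because \<open>add_arc\<close> also inserts the ends
  of the arc into the vertex set.\<close>

lemma one_pair_extensions_eq:
  assumes "u \<in> pverts P" "v \<in> pverts P"
  shows "one_pair_extensions P u v =
    (\<lambda>S. with_proj (P\<lparr>parcs := parcs P \<union> S\<rparr>)) ` Pow {(u,v), (v,u)}"
proof -
  have "verts (with_proj P) \<union> {u,v} = pverts P" "verts (with_proj P) \<union> {v,u} = pverts P"
    using assms by auto
  then show ?thesis
    using assms unfolding one_pair_extensions_def
    by (simp add: Pow_insert pre_digraph.add_arc_def with_proj_def insert_absorb
        insert_commute)
qed

context
  fixes P :: "'v pair_pre_digraph" and u v :: 'v
  assumes P: "pair_digraph P" and uv: "u \<in> pverts P" "v \<in> pverts P"
begin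

lemma wf_digraph_one_pair_extension:
  assumes "Y \<in> one_pair_extensions P u v"
  shows "wf_digraph Y"
proof -
  interpret pair_digraph P by (rule P)
  show ?thesis
    using assms uv unfolding one_pair_extensions_eq[OF uv]
    by (auto simp: wf_digraph_def dest: wellformed')
qed

text \<open>Initially \<open>v\<close> is in none of the three neighbor sets of \<open>u\<close>;
  the arcs in \<open>S\<close> put it into at most one of them and affect no other vertex. The four
  resulting increments are distinct.\<close>

lemma degree_triple_one_pair_extension:
  assumes "u \<noteq> v" "(u,v) \<notin> parcs P" "(v,u) \<notin> parcs P" "S \<subseteq> {(u,v), (v,u)}"
    and "degree_triple (with_proj P) u = (a,b,c)"
  shows "degree_triple (with_proj (P\<lparr>parcs := parcs P \<union> S\<rparr>)) u =
    (a + of_bool ((u,v) \<in> S \<and> (v,u) \<notin> S),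
     b + of_bool ((v,u) \<in> S \<and> (u,v) \<notin> S),
     c + of_bool ((u,v) \<in> S \<and> (v,u) \<in> S))"
proof -
  interpret pair_digraph P by (rule P)
  let ?Y = "with_proj (P\<lparr>parcs := parcs P \<union> S\<rparr>)"
  have "out_neighbors ?Y u = out_neighbors (with_proj P) u \<union>
      (if (u,v) \<in> S \<and> (v,u) \<notin> S then {v} else {})"
    "in_neighbors ?Y u = in_neighbors (with_proj P) u \<union>
      (if (v,u) \<in> S \<and> (u,v) \<notin> S then {v} else {})"
    "strong_neighbors ?Y u = strong_neighbors (with_proj P) u \<union>
      (if (u,v) \<in> S \<and> (v,u) \<in> S then {v} else {})"
    using assms uv by (auto simp: out_neighbors_def in_neighbors_def strong_neighbors_def)
  moreover have "v \<notin> out_neighbors (with_proj P) u" "v \<notin> in_neighbors (with_proj P) u"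
    "v \<notin> strong_neighbors (with_proj P) u" "finite (out_neighbors (with_proj P) u)"
    "finite (in_neighbors (with_proj P) u)" "finite (strong_neighbors (with_proj P) u)"
    using assms pair_finite_verts
    by (auto simp: out_neighbors_def in_neighbors_def strong_neighbors_def)
  ultimately show ?thesis
    using assms(5) by (auto simp: degree_triple_def)
qed

text \<open>Before the extension \<open>u\<close> and \<open>f u\<close> have equal triples, so
  equality afterwards means equal increments. Hence the same arcs, up to \<open>f\<close>, were
  added on both sides, and \<open>f\<close> itself is an isomorphism of the extensions.\<close>

lemma digraph_iso_one_pair_extensions:
  assumes "u \<noteq> v" "(u,v) \<notin> parcs P" "(v,u) \<notin> parcs P"
    and Q: "pair_digraph Q" and f: "ends_iso f (with_proj P) (with_proj Q)"
    and Y: "Y \<in> one_pair_extensions P u v" and Z: "Z \<in> one_pair_extensions Q (f u) (f v)"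
    and dt: "degree_triple Y u = degree_triple Z (f u)"
  shows "digraph_iso Y Z"
proof -
  have inj: "inj_on f (pverts P)" and im: "f ` pverts P = pverts Q"
    and adj: "\<And>x y. x \<in> pverts P \<Longrightarrow> y \<in> pverts P \<Longrightarrow> (f x, f y) \<in> parcs Q \<longleftrightarrow> (x,y) \<in> parcs P"
    using f by (auto simp: ends_iso_def bij_betw_def)
  have fuv: "f u \<in> pverts Q" "f v \<in> pverts Q"
    using im uv by auto
  obtain S where S: "S \<subseteq> {(u,v), (v,u)}" and YS: "Y = with_proj (P\<lparr>parcs := parcs P \<union> S\<rparr>)"
    using Y unfolding one_pair_extensions_eq[OF uv] by blast
  obtain T where T: "T \<subseteq> {(f u, f v), (f v, f u)}"
    and ZT: "Z = with_proj (Q\<lparr>parcs := parcs Q \<union> T\<rparr>)"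
    using Z unfolding one_pair_extensions_eq[OF fuv] by blast
  \<comment> \<open>The qualified name refers to the exported fact, which can be instantiated with
    \<open>Q\<close>; the unqualified one is tied to the fixed \<open>P\<close>, \<open>u\<close>,
    \<open>v\<close>.\<close>
  have wf: "wf_digraph Y" "wf_digraph Z"
    using wf_digraph_one_pair_extension[OF Y]
      Submission.wf_digraph_one_pair_extension[OF Q fuv Z] by auto
  obtain a b c where abc: "degree_triple (with_proj P) u = (a,b,c)"
    by (cases "degree_triple (with_proj P) u")
  have "degree_triple (with_proj Q) (f u) = (a,b,c)"
    using degree_triple_ends_iso[OF f] uv abc by simp
  moreover have "f u \<noteq> f v" "(f u, f v) \<notin> parcs Q" "(f v, f u) \<notin> parcs Q"
    using assms(1-3) uv inj adj by (auto simp: inj_on_eq_iff)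
  ultimately have dtZ: "degree_triple Z (f u) =
      (a + of_bool ((f u, f v) \<in> T \<and> (f v, f u) \<notin> T),
       b + of_bool ((f v, f u) \<in> T \<and> (f u, f v) \<notin> T),
       c + of_bool ((f u, f v) \<in> T \<and> (f v, f u) \<in> T))"
    unfolding ZT using T by (intro Submission.degree_triple_one_pair_extension[OF Q fuv])
  have same: "(f u, f v) \<in> T \<longleftrightarrow> (u,v) \<in> S" "(f v, f u) \<in> T \<longleftrightarrow> (v,u) \<in> S"
    using dt degree_triple_one_pair_extension[OF assms(1-3) S abc] dtZ
    by (auto simp: YS of_bool_def split: if_splits)
  have "(f x, f y) \<in> T \<longleftrightarrow> (x,y) \<in> S" if "x \<in> pverts P" "y \<in> pverts P" for x y
  proof -
    have "f x = f u \<longleftrightarrow> x = u" "f x = f v \<longleftrightarrow> x = v" "f y = f u \<longleftrightarrow> y = u" "f y = f v \<longleftrightarrow> y = v"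
      using inj that uv by (auto simp: inj_on_eq_iff)
    then show ?thesis
      using S T same by blast
  qed
  then have "ends_iso f Y Z"
    using inj im adj by (auto simp: ends_iso_def bij_betw_def YS ZT)
  then show ?thesis
    using wf unfolding YS ZT by (intro ends_iso_imp_digraph_iso nomulti_digraph_with_proj)
qed

end

section \<open>From isomorphic digraphs to a common dapasting\<close>

lemma labeled_iso_refl:
  assumes "wf_digraph (with_proj (fst P))"
  shows "labeled_iso P P"
  unfolding labeled_iso_def
  by (rule exI[of _ "\<lparr>iso_verts = id, iso_arcs = id, iso_head = snd, iso_tail = fst\<rparr>"])
    (use assms in \<open>simp add: pre_digraph.digraph_isomorphism_def app_iso_def with_proj_def\<close>)

lemma nat_copy:
  assumes "digraph D"
  obtains K :: "nat pair_pre_digraph" and f where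
    "pair_digraph K" "ends_iso f D (with_proj K)" "digraph_iso D (with_proj K)"
proof -
  interpret digraph D by fact
  obtain K :: "nat pair_pre_digraph" where iso: "digraph_iso D (with_proj K)"
    using iso_class_nonempty[OF fin_digraph_axioms nomulti_digraph_axioms]
    unfolding iso_class_def by blast
  obtain f where f: "ends_iso f D (with_proj K)"
    using iso by (rule digraph_isoD_ends_iso)
  obtain h where h: "digraph_isomorphism h" "with_proj K = app_iso h D"
    using iso by (auto simp: digraph_iso_def)
  have "fin_digraph (with_proj K)"
    unfolding h(2) using h(1) by (rule fin_digraphI_app_iso)
  then interpret K: fin_digraph "with_proj K" .
  \<comment> \<open>Members of \<open>iso_class D\<close> are not loop-free by definition; a loop of
    \<open>K\<close> would pull back along \<open>f\<close> to a loop of \<open>D\<close>.\<close>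
  have "x \<noteq> y" if "(x,y) \<in> parcs K" for x y
  proof
    assume "x = y"
    have "x \<in> pverts K"
      using K.tail_in_verts[of "(x,y)"] that by simp
    then obtain w where "w \<in> verts D" "x = f w"
      using f unfolding ends_iso_def bij_betw_def with_proj_simps by blast
    then have "(w,w) \<in> arcs_ends D"
      using f that \<open>x = y\<close> by (auto simp: ends_iso_def)
    then show False
      using no_loops by (auto simp: arcs_ends_conv)
  qed
  then have "pair_digraph K"
    using K.finite_verts K.finite_arcs K.tail_in_verts K.head_in_verts
    by unfold_locales auto
  then show ?thesis
    using f iso by (rule that)
qed

text \<open>One dapasting serves both digraphs: a copy \<open>K\<close> of \<open>G\<close> on
  natural numbers, stripped of the arcs between the images of \<open>x\<close> and \<open>y\<close>,
  has \<open>K\<close> as completion witness, and \<open>K\<close> is isomorphic to \<open>G\<close>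
  and to \<open>H\<close>.\<close>

lemma dapasted_isomorphically_if_digraph_iso:
  fixes G :: "('a,'b) pre_digraph" and H :: "('c,'d) pre_digraph"
  assumes G: "digraph G" and GH: "digraph_iso G H"
    and xy: "x \<in> verts G" "y \<in> verts G" "x \<noteq> y"
  shows "dapasted_isomorphically G H (dacard G x) (dacard G y)"
proof -
  interpret G: digraph G by fact
  obtain K :: "nat pair_pre_digraph" and f where K: "pair_digraph K"
    and f: "ends_iso f G (with_proj K)" and GK: "digraph_iso G (with_proj K)"
    using nat_copy[OF G] .
  interpret K: pair_digraph K by fact
  have KG: "digraph_iso (with_proj K) G"
    using GK G.wf_digraph by (rule digraph_iso_swap[rotated])
  define u v where "u = f x" and "v = f y"
  have uv: "u \<in> pverts K" "v \<in> pverts K" "u \<noteq> v"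
    using f xy by (auto simp: ends_iso_def bij_betw_def u_def v_def inj_on_eq_iff)
  define P where "P = K\<lparr>parcs := parcs K - {(u,v), (v,u)}\<rparr>"
  have P_uv: "u \<in> pverts P" "v \<in> pverts P"
    using uv by (simp_all add: P_def)
  have P_digraph: "pair_digraph P"
    using K.pair_finite_verts K.pair_finite_arcs K.pair_no_loops K.arc_fst_in_verts
      K.arc_snd_in_verts by unfold_locales (auto simp: P_def)
  have nomulti_K: "nomulti_digraph (with_proj K)"
    using K.wf_digraph by (rule nomulti_digraph_with_proj)
  have del_P: "digraph_iso (pre_digraph.del_vert (with_proj P) (f w)) (pre_digraph.del_vert G w)"
    if w: "w = x \<or> w = y" for w
  proof -
    \<comment> \<open>Every arc removed from \<open>K\<close> is incident with both \<open>u\<close>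
      and \<open>v\<close>, so it disappears anyway when either is deleted.\<close>
    have "pre_digraph.del_vert (with_proj P) (f w) = pre_digraph.del_vert (with_proj K) (f w)"
      using w by (auto simp: pre_digraph.del_vert_def P_def u_def v_def)
    moreover have "digraph_iso (pre_digraph.del_vert G w) (pre_digraph.del_vert (with_proj K) (f w))"
      using w xy f nomulti_K G.nomulti_digraph
      by (blast intro: ends_iso_imp_digraph_iso nomulti_digraph_del_vert ends_iso_del_vert)
    ultimately show ?thesis
      using digraph_iso_swap[OF G.wf_digraph_del_vert] by simp
  qed
  let ?S = "parcs K \<inter> {(u,v), (v,u)}"
  have "K = P\<lparr>parcs := parcs P \<union> ?S\<rparr>"
    by (auto simp: P_def Un_Diff_Int)
  then have K_ext: "with_proj K \<in> one_pair_extensions P u v"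
    unfolding one_pair_extensions_eq[OF P_uv] by (rule image_eqI[OF arg_cong]) simp
  define l where "l w = (if w = u then External (degree_triple G x)
    else if w = v then External (degree_triple G y) else Unlabeled)" for w
  have "da_hypomorphic (with_proj K) G"
    using K.fin_digraph_axioms nomulti_K G.fin_digraph_axioms G.nomulti_digraph KG
    by (rule da_hypomorphic_if_digraph_iso)
  then have via: "dapasting_via G (dacard G x) (dacard G y) (P,l) u v (with_proj K)"
    using uv P_digraph K_ext del_P[of x] del_P[of y] xy
      degree_triple_ends_iso[OF f xy(1)] degree_triple_ends_iso[OF f xy(2)]
    by (auto simp: dapasting_via_def dacard_def l_def u_def v_def P_def)
  interpret P: pair_digraph P by fact
  have "labeled_iso (P,l) (P,l)"
    using P.wf_digraph by (intro labeled_iso_refl) simp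
  then show ?thesis
    using via KG digraph_iso_trans[OF KG GH]
    unfolding dapasted_isomorphically_def dapasting_in_def dapasting_def completion_def by blast
qed

section \<open>From isomorphic dapastings to isomorphic digraphs\<close>

lemma digraph_iso_if_dapasted_isomorphically:
  fixes G :: "('a,'b) pre_digraph" and H :: "('c,'d) pre_digraph"
  assumes "dapasted_isomorphically G H a b"
  shows "digraph_iso G H"
proof -
  obtain A \<alpha> B \<beta> where ab: "a = (A,\<alpha>)" "b = (B,\<beta>)"
    by (cases a, cases b)
  \<comment> \<open>External vertices and witnesses come from the completion clauses, so that
    \<open>Y1\<close> and \<open>Y2\<close> are the extensions isomorphic to \<open>G\<close> and
    \<open>H\<close>.\<close>
  obtain P1 l1 P2 l2 u1 v1 Y1 u2 v2 Y2 where
    via1: "dapasting_via G a b (P1 :: nat pair_pre_digraph, l1) u1 v1 Y1"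
    and Y1G: "digraph_iso Y1 G"
    and via2: "dapasting_via G a b (P2 :: nat pair_pre_digraph, l2) u2 v2 Y2"
    and Y2H: "digraph_iso Y2 H"
    and iso: "labeled_iso (P1,l1) (P2,l2)"
    using assms unfolding dapasted_isomorphically_def dapasting_in_def completion_def
    by (metis surj_pair)
  have 1: "pair_digraph P1" "u1 \<in> pverts P1" "v1 \<in> pverts P1" "u1 \<noteq> v1"
    "(u1,v1) \<notin> parcs P1" "(v1,u1) \<notin> parcs P1" "l1 u1 = External \<alpha>" "l1 v1 = External \<beta>"
    "Y1 \<in> one_pair_extensions P1 u1 v1" "degree_triple Y1 u1 = \<alpha>"
    using via1 by (auto simp: dapasting_via_def ab)
  have 2: "pair_digraph P2" "u2 \<in> pverts P2" "v2 \<in> pverts P2"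
    "l2 u2 = External \<alpha>" "l2 v2 = External \<beta>" "\<forall>w \<in> pverts P2 - {u2,v2}. l2 w = Unlabeled"
    "Y2 \<in> one_pair_extensions P2 u2 v2" "degree_triple Y2 u2 = \<alpha>" "degree_triple Y2 v2 = \<beta>"
    using via2 by (auto simp: dapasting_via_def ab)
  obtain f where f: "ends_iso f (with_proj P1) (with_proj P2)"
    and lab: "\<And>w. w \<in> pverts P1 \<Longrightarrow> l2 (f w) = l1 w"
    using iso ends_iso_app_iso unfolding labeled_iso_def by (metis fst_conv snd_conv)
  have f_verts: "f u1 \<in> pverts P2" "f v1 \<in> pverts P2" "f u1 \<noteq> f v1"
    using f 1 by (auto simp: ends_iso_def bij_betw_def inj_on_eq_iff)
  have l2f: "l2 (f u1) = External \<alpha>" "l2 (f v1) = External \<beta>"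
    using lab 1 by auto
  \<comment> \<open>All vertices of \<open>P2\<close> other than \<open>u2\<close> and
    \<open>v2\<close> are unlabeled, whereas \<open>f\<close> preserves external labels.\<close>
  have "f u1 \<in> {u2,v2}" "f v1 \<in> {u2,v2}"
    using f_verts l2f 2(6) by force+
  then consider "f u1 = u2" "f v1 = v2" | "f u1 = v2" "f v1 = u2"
    using f_verts by auto
  then have "Y2 \<in> one_pair_extensions P2 (f u1) (f v1) \<and> degree_triple Y2 (f u1) = \<alpha>"
  proof cases
    case 1
    then show ?thesis
      using 2 by simp
  next
    \<comment> \<open>The external vertices can be interchanged only if their labels coincide. Then
      \<open>v2\<close> also has triple \<alpha> in \<open>Y2\<close>, and the set of extensions is
      symmetric in the two vertices.\<close>
    case swap: 2
    then have "\<alpha> = \<beta>"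
      using l2f 2 by simp
    then show ?thesis
      using swap 2 one_pair_extensions_eq[of u2 P2 v2] one_pair_extensions_eq[of v2 P2 u2]
      by (simp add: insert_commute)
  qed
  then have "digraph_iso Y1 Y2"
    using 1 2(1) f by (intro digraph_iso_one_pair_extensions[of P1 u1 v1 P2 f]) auto
  moreover have "digraph_iso G Y1"
    using wf_digraph_one_pair_extension[OF 1(1-3,9)] Y1G by (rule digraph_iso_swap)
  ultimately show ?thesis
    using Y2H by (intro digraph_iso_trans[OF digraph_iso_trans, of G Y1 Y2 H])
qed

theorem theorem5p8:
  fixes G :: "('a,'b) pre_digraph" and H :: "('c,'d) pre_digraph"
  assumes "digraph G" and "digraph H"
    and "card (verts G) \<ge> 2"
    and "da_hypomorphic G H"
  shows "digraph_iso G H \<longleftrightarrow>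
    (\<exists>x \<in> verts G. \<exists>y \<in> verts G. x \<noteq> y \<and>
       dapasted_isomorphically G H (dacard G x) (dacard G y))"
proof
  assume "digraph_iso G H"
  \<comment> \<open>Any two distinct vertices serve as the required pair.\<close>
  moreover obtain x y where "x \<in> verts G" "y \<in> verts G" "x \<noteq> y"
    using \<open>card (verts G) \<ge> 2\<close>
    by (auto simp: numeral_2_eq_2 card_le_Suc_iff)
  ultimately show "\<exists>x \<in> verts G. \<exists>y \<in> verts G. x \<noteq> y \<and>
      dapasted_isomorphically G H (dacard G x) (dacard G y)"
    using dapasted_isomorphically_if_digraph_iso[OF \<open>digraph G\<close>] by blast
qed (blast intro: digraph_iso_if_dapasted_isomorphically)

end
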